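(* Let $n$ and $k$ be integers with $1\le k\le n$ that are either both even or both odd. Among the $2^{n+2}$ assignments of over/under data to the crossings of the free $2\ n$ knot, exactly $2\binom{n}{\frac{n-k}{2}}$ produce the $2\ k$ knot and exactly $2\binom{n}{\frac{n-k}{2}}$ produce the $2\ (k-1)$ knot; here, when $k=1$, the $2\ 0$ knot is the unknot and the second count refers to those assignments producing the unknot in which the two crossings of the vertical $2$-tangle do not cancel by a second Reidemeister move.
   Context: The free $2\ m$ knot ($m\ge 0$) is the following planar closed curve with $m+2$ double points (the free closure of Conway's $2\ m$ tangle). Take a horizontal row of $m$ crossings: two parallel horizontal strands crossing each other $m$ times in succession, with four ends (upper-left, lower-left, upper-right, lower-right). Above it place a vertical column of $2$ crossings (the vertical $2$-tangle): two parallel vertical strands crossing each other twice in succession, with four ends. Join the lower-left end of the column to the upper-left end of the row, the lower-right end of the column to the upper-right end of the row, the upper-left end of the column to the lower-left end of the row (by an arc around the left side), and the upper-right end of the column to the lower-right end of the row (by an arc around the right side), without creating further crossings. An assignment is a choice, at each crossing, of which of the two strands is the overstrand. For $m\ge 1$ the $2\ m$ knot is the knot obtained from the free $2\ m$ knot by an alternating assignment (it is the closure of the rational tangle with continued fraction $m+\frac12$); e.g. $2\ 1$ is the trefoil and $2\ 2$ is the figure eight. The $2\ 0$ knot is the unknot. Knots are not distinguished from their mirror images. *)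

theory Defs
  imports Complex_Main
begin

section \<open>Plane curves and knot diagrams\<close>

text \<open>
  A closed plane curve with transverse double points, in general position with respect to the
  horizontal coordinate, is swept by a vertical line from left to right and recorded as the list of
  the events met on the way: a birth \<open>Cup\<close> of two neighbouring strands (left turning point,
  the shape of the letter C), a death \<open>Cap\<close> of two neighbouring strands (right turning point)
  and a double point \<open>Cross\<close> of two neighbouring strands.  The strands met by the sweeping
  line are numbered 0, 1, 2, \<dots> from top to bottom, and an event carries the number of the topmost
  strand it involves (for a \<open>Cup\<close>: of the upper one of the two new strands).

  The argument of \<open>Cross\<close> is the information attached to the double point.  It is of type
  \<open>unit\<close> for a bare curve.  In a knot diagram it is of type \<open>bool\<close>: \<open>True\<close> means
  that the strand descending from upper left to lower right is the overstrand, \<open>False\<close> that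
  the strand ascending from lower left to upper right is.
\<close>

datatype 'a event = Cup | Cap | Cross 'a

type_synonym 'a picture = "('a event \<times> nat) list"

type_synonym diagram = "bool picture"

fun ins :: "'a event \<Rightarrow> nat" where
  "ins Cup = 0"
| "ins Cap = 2"
| "ins (Cross c) = 2"

fun outs :: "'a event \<Rightarrow> nat" where
  "outs Cup = 2"
| "outs Cap = 0"
| "outs (Cross c) = 2"

text \<open>\<open>strands m D n\<close>: the word \<open>D\<close> makes sense with \<open>m\<close> strands entering
  on the left, and then \<open>n\<close> strands leave on the right.\<close>

fun strands :: "nat \<Rightarrow> 'a picture \<Rightarrow> nat \<Rightarrow> bool" where
  "strands m [] n \<longleftrightarrow> m = n"
| "strands m ((e, i) # D) n \<longleftrightarrow> i + ins e \<le> m \<and> strands (m - ins e + outs e) D n"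

abbreviation closed_picture :: "'a picture \<Rightarrow> bool" where
  "closed_picture D \<equiv> strands 0 D 0"

definition shadow :: "'a picture \<Rightarrow> unit picture" where
  "shadow D = map (\<lambda>(e, i). (map_event (\<lambda>_. ()) e, i)) D"

text \<open>The assignments of over/under data to the double points of a curve are identified with the
  diagrams obtained.\<close>

definition assignments :: "unit picture \<Rightarrow> diagram set" where
  "assignments S = {D. shadow D = S}"

definition mirror :: "diagram \<Rightarrow> diagram" where
  "mirror D = map (\<lambda>(e, i). (map_event Not e, i)) D"


section \<open>Knot equivalence\<close>

text \<open>
  Two parallel vertical strands crossing each other twice, occupying the levels \<open>i\<close>
  (upper ends) and \<open>i + 1\<close> (lower ends).  The upper crossing carries \<open>a\<close>, the lower
  one \<open>b\<close>; they are joined by the left arc \<open>(Cup, i + 1)\<close> and by the right arc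
  \<open>(Cap, i + 1)\<close>.
\<close>

definition column :: "'a \<Rightarrow> 'a \<Rightarrow> nat \<Rightarrow> 'a picture" where
  "column a b i = [(Cup, i + 1), (Cross a, i), (Cross b, i + 2), (Cap, i + 1)]"

text \<open>
  The planar isotopies and the Reidemeister moves, for diagrams swept as above (the usual local
  moves of sliced diagrams, also called Turaev moves).  The first four rules (from \<open>commute\<close>
  to \<open>slide_cap\<close>) are the planar isotopies: two distant events are met in the other order, a
  pair of turning points is straightened, a crossing is turned past a turning point.  In
  \<open>commute\<close> the event \<open>e\<close> lies above \<open>f\<close>, whence the shift of the number at
  \<open>f\<close>.  In \<open>slide_cup\<close> and \<open>slide_cap\<close> the strand moved across the turning point
  descends on one side and ascends on the other, so keeping it over (or under) negates the bit; so
  does the return crossing in \<open>R2\<close>.  In \<open>R3\<close> the bits \<open>a\<close>, \<open>b\<close>, \<open>c\<close>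
  belong to the pairs of strands 12, 13, 23 (numbered as they enter), and the side condition excludes
  exactly the two cyclic choices, in which no strand is over both others.  In \<open>R1_cup\<close> and
  \<open>R1_cap\<close> the kink sits at a turning point; \<open>R2_turned\<close> is \<open>R2\<close> for vertical
  strands (the same strand is over at both crossings of a column iff the bits differ).
\<close>

inductive local_move :: "diagram \<Rightarrow> diagram \<Rightarrow> bool" where
  commute: "local_move [(e, i), (f, i + outs e + k)] [(f, i + ins e + k), (e, i)]"
| straighten_down: "local_move [(Cup, i), (Cap, i + 1)] []"
| straighten_up: "local_move [(Cup, i + 1), (Cap, i)] []"
| slide_cup: "local_move [(Cup, i + 1), (Cross s, i)] [(Cup, i), (Cross (\<not> s), i + 1)]"
| slide_cap: "local_move [(Cross s, i), (Cap, i + 1)] [(Cross (\<not> s), i + 1), (Cap, i)]"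
| R1_cup: "local_move [(Cup, i), (Cross s, i)] [(Cup, i)]"
| R1_cap: "local_move [(Cross s, i), (Cap, i)] [(Cap, i)]"
| R2: "local_move [(Cross s, i), (Cross (\<not> s), i)] []"
| R2_turned: "local_move (column s (\<not> s) i) [(Cap, i), (Cup, i)]"
| R3: "a = b \<or> b = c \<Longrightarrow>
    local_move [(Cross a, i), (Cross b, i + 1), (Cross c, i)]
               [(Cross c, i + 1), (Cross b, i), (Cross a, i + 1)]"

inductive move :: "diagram \<Rightarrow> diagram \<Rightarrow> bool" where
  "local_move X Y \<Longrightarrow> closed_picture (U @ X @ V) \<Longrightarrow> closed_picture (U @ Y @ V)
    \<Longrightarrow> move (U @ X @ V) (U @ Y @ V)"

definition isotopic :: "diagram \<Rightarrow> diagram \<Rightarrow> bool" where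
  "isotopic = equivclp move"

text \<open>Knots are not distinguished from their mirror images.\<close>

definition same_knot :: "diagram \<Rightarrow> diagram \<Rightarrow> bool" where
  "same_knot D E \<longleftrightarrow> isotopic D E \<or> isotopic D (mirror E)"

definition unknot :: diagram where
  "unknot = [(Cup, 0), (Cap, 0)]"


section \<open>Alternating diagrams\<close>

text \<open>
  A diagram is alternating if along the curve overpasses and underpasses alternate, that is, if
  every piece of the curve between two consecutive passes through crossings runs from an overpass to
  an underpass.  Label every strand met by the sweeping line by \<open>True\<close> if, following the curve
  from there to the right, the next pass is an overpass, and by \<open>False\<close> if it is an
  underpass; alternation means that following the curve to the left the next pass is then of the
  opposite kind.  Hence the two strands at a turning point have opposite labels.  At a crossing with
  bit \<open>s\<close> the strand entering on the upper left is over iff \<open>s\<close>, so the labels entering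
  are \<open>s, \<not> s\<close>; the strand leaving on the upper right is the ascending one, which is over iff
  \<open>\<not> s\<close>, so its label (opposite to the pass on its left) is \<open>s\<close>, and the labels leaving
  are again \<open>s, \<not> s\<close>.
\<close>

inductive alt_labels :: "bool list \<Rightarrow> diagram \<Rightarrow> bool list \<Rightarrow> bool" where
  "alt_labels xs [] xs"
| "alt_labels (us @ [t, \<not> t] @ vs) D ys \<Longrightarrow> length us = i
    \<Longrightarrow> alt_labels (us @ vs) ((Cup, i) # D) ys"
| "alt_labels (us @ vs) D ys \<Longrightarrow> length us = i
    \<Longrightarrow> alt_labels (us @ [t, \<not> t] @ vs) ((Cap, i) # D) ys"
| "alt_labels (us @ [s, \<not> s] @ vs) D ys \<Longrightarrow> length us = i
    \<Longrightarrow> alt_labels (us @ [s, \<not> s] @ vs) ((Cross s, i) # D) ys"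

definition alternating :: "diagram \<Rightarrow> bool" where
  "alternating D \<longleftrightarrow> alt_labels [] D []"


section \<open>The free \<open>2 m\<close> knot and the \<open>2 m\<close> knot\<close>

text \<open>
  After the first two events the four strands are, from top to bottom, the upper-left and lower-left
  ends of the column and the upper-left and lower-left ends of the row: the outer arc goes around the
  left side, the inner one joins the column to the row.  The last two events do the same on the
  right.
\<close>

definition free_two :: "nat \<Rightarrow> unit picture" where
  "free_two m = [(Cup, 0), (Cup, 1)] @ column () () 0 @ replicate m (Cross (), 2)
     @ [(Cap, 1), (Cap, 0)]"

fun is_two_knot :: "nat \<Rightarrow> diagram \<Rightarrow> bool" where
  "is_two_knot 0 D \<longleftrightarrow> same_knot D unknot"
| "is_two_knot (Suc m) D \<longleftrightarrow>
     (\<exists>E \<in> assignments (free_two (Suc m)). alternating E \<and> same_knot D E)"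

text \<open>For an assignment of a free \<open>2 m\<close> knot: the second Reidemeister move
  \<open>R2_turned\<close> applies to the two crossings of its column.\<close>

definition column_cancels :: "diagram \<Rightarrow> bool" where
  "column_cancels D \<longleftrightarrow> (\<exists>s E. D = [(Cup, 0), (Cup, 1)] @ column s (\<not> s) 0 @ E)"

lemma closed_free_two: "closed_picture (free_two m)"
proof -
  have "strands 4 (replicate m (Cross (), 2) @ [(Cap, 1), (Cap, 0)]) 0"
    by (induction m) auto
  then show ?thesis by (simp add: free_two_def column_def numeral_eq_Suc)
qed

text \<open>The free \<open>2 m\<close> knot has an alternating assignment, so \<open>is_two_knot\<close> is not
  vacuous.\<close>

lemma alternating_assignment_exists:
  "\<exists>E \<in> assignments (free_two m). alternating E"
proof -
  define E :: diagram where "E = [(Cup, 0), (Cup, 1)] @ column True True 0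
     @ replicate m (Cross True, 2) @ [(Cap, 1), (Cap, 0)]"
  have cap0: "alt_labels [True, False] [(Cap, 0)] []"
    using alt_labels.intros(3)[of "[]" "[]" "[]" "[]" 0 True] by (simp add: alt_labels.intros(1))
  have caps: "alt_labels [True, False, True, False] [(Cap, 1), (Cap, 0)] []"
    using alt_labels.intros(3)[of "[True]" "[False]" _ "[]" 1 False] cap0 by simp
  have row: "alt_labels [True, False, True, False]
      (replicate m (Cross True, 2) @ [(Cap, 1), (Cap, 0)]) []" (is "alt_labels _ ?R _")
  proof (induction m)
    case 0
    then show ?case using caps by simp
  next
    case (Suc m)
    then show ?case
      using alt_labels.intros(4)[of "[True, False]" True "[]" _ "[]" 2] by simp
  qed
  have c3: "alt_labels [True, False, True, False, True, False] ((Cap, 1) # ?R) []"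
    using alt_labels.intros(3)[of "[True]" "[False, True, False]" _ "[]" 1 False] row by simp
  have c2: "alt_labels [True, False, True, False, True, False]
      ((Cross True, 2) # (Cap, 1) # ?R) []"
    using alt_labels.intros(4)[of "[True, False]" True "[True, False]" _ "[]" 2] c3 by simp
  have c1: "alt_labels [True, False, True, False, True, False]
      ((Cross True, 0) # (Cross True, 2) # (Cap, 1) # ?R) []"
    using alt_labels.intros(4)[of "[]" True "[True, False, True, False]" _ "[]" 0] c2 by simp
  have c0: "alt_labels [True, False, True, False] (column True True 0 @ ?R) []"
    using alt_labels.intros(2)[of "[True]" False "[False, True, False]" _ "[]" 1] c1
    by (simp add: column_def numeral_eq_Suc)
  have b1: "alt_labels [True, False] ((Cup, 1) # column True True 0 @ ?R) []"
    using alt_labels.intros(2)[of "[True]" False "[False]" _ "[]" 1] c0 by simp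
  have "alternating E"
    using alt_labels.intros(2)[of "[]" True "[]" _ "[]" 0] b1
    by (simp add: E_def alternating_def)
  moreover have "E \<in> assignments (free_two m)"
    by (simp add: assignments_def shadow_def E_def free_two_def column_def)
  ultimately show ?thesis by blast
qed

end

theory Submission
  imports Defs
begin

text \<open>
  If the bits of the column differ, the column cancels.  If both are \<open>a\<close>, second Reidemeister
  moves reduce the row to \<open>\<bar>v\<bar>\<close> equal crossings, where \<open>v\<close> is the number of
  crossings of the row with bit \<open>a\<close> minus the number of the others.  For \<open>v \<ge> 0\<close>
  this is the alternating diagram of the \<open>2 v\<close> knot; for \<open>v < 0\<close> one third
  Reidemeister move absorbs a row crossing into the column and negates its bits
  (\<open>1/2 - 1 = - 1/2\<close> in terms of rational tangles), which leaves the
  \<open>2 (- v - 1)\<close> knot.  The determinant \<open>\<bar>2 v + 1\<bar>\<close>, seen through the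
  number of Fox colourings modulo all \<open>q\<close>, tells these knots apart, so
  that the assignments producing a given knot are counted by a binomial coefficient.
\<close>

section \<open>Fox colourings\<close>

text \<open>The Fox relation: the overstrand keeps its colour and the understrand is reflected in
  it, colours being listed from top to bottom on both sides. With bit \<open>True\<close> the
  overstrand enters above and leaves below.\<close>

fun crossing :: "int \<Rightarrow> bool \<Rightarrow> int \<Rightarrow> int \<Rightarrow> int list" where
  "crossing q True x y = [(2 * x - y) mod q, x]"
| "crossing q False x y = [y, (2 * y - x) mod q]"

text \<open>Sets of continuations turn the count into a state sum: a birth branches into
  \<open>q\<close> colours, a crossing has one continuation, a death of unequal colours has
  none.\<close>

fun outcomes :: "int \<Rightarrow> bool event \<Rightarrow> int list \<Rightarrow> int list set" where
  "outcomes q Cup xs = (\<lambda>t. [t, t]) ` {0..<q}"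
| "outcomes q Cap xs = (if xs ! 0 = xs ! 1 then {[]} else {})"
| "outcomes q (Cross s) xs = {crossing q s (xs ! 0) (xs ! 1)}"

text \<open>\<open>colourings q D xs\<close> is the number of Fox colourings of \<open>D\<close> modulo
  \<open>q\<close> which restrict to \<open>xs\<close> on the strands entering on the left.\<close>

fun colourings :: "int \<Rightarrow> diagram \<Rightarrow> int list \<Rightarrow> nat" where
  "colourings q [] xs = 1"
| "colourings q ((e, i) # D) xs =
     (\<Sum>ys \<in> outcomes q e (take (ins e) (drop i xs)).
        colourings q D (take i xs @ ys @ drop (i + ins e) xs))"

declare colourings.simps(2) [simp del]

section \<open>Evaluating the count on explicit lists of colours\<close>

lemma sum_outcomes_Cup:
  "(\<Sum>ys \<in> outcomes q Cup xs. f ys) = (\<Sum>t \<in> {0..<q}. f [t, t])"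
  by (simp add: sum.reindex inj_on_def)

lemma colourings_split:
  assumes "length us = i" "length ps = ins e"
  shows "colourings q ((e, i) # D) (us @ ps @ vs) =
    (\<Sum>ys \<in> outcomes q e ps. colourings q D (us @ ys @ vs))"
  using assms by (simp add: colourings.simps(2))

lemma colourings_Cup:
  "length us = i \<Longrightarrow> colourings q ((Cup, i) # D) (us @ vs) =
    (\<Sum>t \<in> {0..<q}. colourings q D (us @ t # t # vs))"
  using colourings_split[of us i "[]" Cup q D vs]
  by (simp only: sum_outcomes_Cup) simp

lemma colourings_Cap:
  "length us = i \<Longrightarrow> colourings q ((Cap, i) # D) (us @ x # y # vs) =
    (if x = y then colourings q D (us @ vs) else 0)"
  using colourings_split[of us i "[x, y]" Cap q D vs] by simp

lemma colourings_Cross: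
  "length us = i \<Longrightarrow> colourings q ((Cross s, i) # D) (us @ x # y # vs) =
    colourings q D (us @ crossing q s x y @ vs)"
  using colourings_split[of us i "[x, y]" "Cross s" q D vs] by simp

lemmas colourings_event = colourings_Cup colourings_Cap colourings_Cross

text \<open>Local moves involve neighbouring levels, so the rules are also needed for events one or
  two strands below the cut.\<close>

lemmas colourings_event_Suc =
  colourings_event[where us = "us @ [u]" for us u, simplified]

lemmas colourings_event_Suc2 =
  colourings_event[where us = "us @ [u, v]" for us u v, simplified]

lemma crossing_length: "length (crossing q s x y) = 2"
  by (cases s) auto

lemma outcomes_length:
  "ys \<in> outcomes q e ps \<Longrightarrow> length ys = outs e"
  by (cases e) (auto simp: crossing_length split: if_splits)

lemma outcomes_range:
  assumes "ys \<in> outcomes q e ps" "length ps = ins e" "set ps \<subseteq> {0..<q}"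
  shows "set ys \<subseteq> {0..<q}"
proof (cases e)
  case (Cross s)
  with assms(2) obtain x y where "ps = [x, y]"
    by (auto simp: numeral_eq_Suc length_Suc_conv)
  then show ?thesis using assms Cross by (cases s) auto
qed (use assms in \<open>auto split: if_splits\<close>)

section \<open>Reflections modulo \<open>q\<close>\<close>

lemma reflect_mod_eq_iff:
  fixes q :: int
  assumes "x \<in> {0..<q}" "z \<in> {0..<q}"
  shows "(2 * y - x) mod q = z \<longleftrightarrow> (2 * y - z) mod q = x"
proof -
  have "(2 * y - x) mod q = z \<longleftrightarrow> q dvd (2 * y - x) - z"
    using assms mod_eq_dvd_iff[of "2 * y - x" q z] by simp
  also have "(2 * y - x) - z = (2 * y - z) - x" by simp
  also have "q dvd (2 * y - z) - x \<longleftrightarrow> (2 * y - z) mod q = x"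
    using assms mod_eq_dvd_iff[of "2 * y - z" q x] by simp
  finally show ?thesis .
qed

lemma reflect_mod_inject:
  fixes q :: int
  assumes "x \<in> {0..<q}" "y \<in> {0..<q}"
  shows "(c - x) mod q = (c - y) mod q \<longleftrightarrow> x = y"
proof -
  have "(c - x) mod q = (c - y) mod q \<longleftrightarrow> q dvd y - x"
    by (simp add: mod_eq_dvd_iff)
  also have "\<dots> \<longleftrightarrow> y mod q = x mod q" by (simp add: mod_eq_dvd_iff)
  finally show ?thesis using assms by auto
qed

text \<open>Reflection in \<open>c\<close> is an involution of \<open>{0..<q}\<close>, so it may
  reindex the sum over the colour of a new arc.\<close>

lemma sum_reflect_mod:
  fixes q :: int
  shows "(\<Sum>t \<in> {0..<q}. f ((2 * c - t) mod q) t) =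
    (\<Sum>t \<in> {0..<q}. f t ((2 * c - t) mod q))"
  by (rule sum.reindex_bij_witness[where i = "\<lambda>t. (2 * c - t) mod q" and
        j = "\<lambda>t. (2 * c - t) mod q"]) (auto simp: mod_simps)

text \<open>The identities behind \<open>R3\<close>. With x |> y for 2x - y, the first is
  self-distributivity, (x |> y) |> (x |> z) = x |> (y |> z). The second, y |> ((y |> x) |> z) = x |>
  (y |> z), follows from it since reflection in y is an involution.\<close>

lemma reflect_mod_distrib:
  fixes q :: int
  shows "(2 * ((2 * x - y) mod q) - (2 * x - z) mod q) mod q = (2 * x - (2 * y - z) mod q) mod q"
    (is ?A)
    and "(2 * y - (2 * ((2 * y - x) mod q) - z) mod q) mod q = (2 * x - (2 * y - z) mod q) mod q"
    (is ?B)
proof -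
  have m: "a mod q = a - q * (a div q)" for a by (simp add: minus_mult_div_eq_mod)
  have "2 * ((2 * x - y) mod q) - (2 * x - z) mod q - (2 * x - (2 * y - z) mod q) =
    q * ((2 * x - z) div q - 2 * ((2 * x - y) div q) - (2 * y - z) div q)"
    unfolding m by (simp add: algebra_simps)
  then show ?A by (metis dvd_triv_left mod_eq_dvd_iff)
  have "2 * y - (2 * ((2 * y - x) mod q) - z) - (2 * x - (2 * y - z)) =
    q * (2 * ((2 * y - x) div q))"
    unfolding m by (simp add: algebra_simps)
  then have "(2 * y - (2 * ((2 * y - x) mod q) - z)) mod q = (2 * x - (2 * y - z)) mod q"
    by (metis dvd_triv_left mod_eq_dvd_iff)
  then show ?B by (simp add: mod_simps)
qed

lemma split_at:
  assumes "i \<le> length xs"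
  obtains us vs where "xs = us @ vs" "length us = i"
  using assms that[of "take i xs" "drop i xs"] by simp

lemma split_at1:
  assumes "i + 1 \<le> length xs"
  obtains us x vs where "xs = us @ x # vs" "length us = i"
  using assms by (metis Cons_nth_drop_Suc Suc_eq_plus1 Suc_le_eq append_take_drop_id
      length_take min.absorb2 order_less_imp_le)

lemma split_at2:
  assumes "i + 2 \<le> length xs"
  obtains us x y vs where "xs = us @ x # y # vs" "length us = i"
proof -
  obtain us x ws where "xs = us @ x # ws" "length us = i"
    using assms split_at1[of i xs] by auto
  moreover from this assms obtain y vs where "ws = y # vs" by (cases ws) auto
  ultimately show thesis using that by blast
qed

lemma split_at3:
  assumes "i + 3 \<le> length xs"
  obtains us x y z vs where "xs = us @ x # y # z # vs" "length us = i"
proof -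
  obtain us x y ws where "xs = us @ x # y # ws" "length us = i"
    using assms by (auto intro: split_at2[of i xs])
  moreover from this assms obtain z vs where "ws = z # vs" by (cases ws) auto
  ultimately show thesis using that by blast
qed

section \<open>Invariance of the count under the moves\<close>

lemma colourings_commute:
  assumes "i + ins e + k + ins f \<le> length xs"
  shows "colourings q ((e, i) # (f, i + outs e + k) # V) xs =
    colourings q ((f, i + ins e + k) # (e, i) # V) xs"
proof -
  obtain us ws1 where 1: "xs = us @ ws1" "length us = i"
    using assms split_at[of i xs] by (metis add_leD1)
  then obtain ps ws2 where 2: "ws1 = ps @ ws2" "length ps = ins e"
    using assms split_at[of "ins e" ws1] by auto
  with 1 obtain ms ws3 where 3: "ws2 = ms @ ws3" "length ms = k"
    using assms split_at[of k ws2] by auto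
  with 1 2 obtain qs vs where 4: "ws3 = qs @ vs" "length qs = ins f"
    using assms split_at[of "ins f" ws3] by auto
  have "colourings q ((e, i) # (f, i + outs e + k) # V) xs =
      (\<Sum>ys \<in> outcomes q e ps. colourings q ((f, i + outs e + k) # V) (us @ ys @ ms @ qs @ vs))"
    using 1 2 3 4 colourings_split[of us i ps e q _ "ms @ qs @ vs"] by simp
  also have "\<dots> = (\<Sum>ys \<in> outcomes q e ps. \<Sum>zs \<in> outcomes q f qs.
      colourings q V (us @ ys @ ms @ zs @ vs))"
  proof (rule sum.cong[OF refl])
    fix ys assume "ys \<in> outcomes q e ps"
    then have "length (us @ ys @ ms) = i + outs e + k"
      using 1 3 outcomes_length by simp
    from colourings_split[OF this 4(2)]
    show "colourings q ((f, i + outs e + k) # V) (us @ ys @ ms @ qs @ vs) =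
      (\<Sum>zs \<in> outcomes q f qs. colourings q V (us @ ys @ ms @ zs @ vs))"
      by simp
  qed
  \<comment> \<open>The blocks \<open>ps\<close> and \<open>qs\<close> are disjoint, so the choices
    at the two events are independent.\<close>
  also have "\<dots> = (\<Sum>zs \<in> outcomes q f qs. \<Sum>ys \<in> outcomes q e ps.
      colourings q V (us @ ys @ ms @ zs @ vs))"
    by (rule sum.swap)
  also have "\<dots> = (\<Sum>zs \<in> outcomes q f qs. colourings q ((e, i) # V) (us @ ps @ ms @ zs @ vs))"
    using colourings_split[OF 1(2) 2(2)] by simp
  also have "\<dots> = colourings q ((f, i + ins e + k) # (e, i) # V) xs"
    using 1 2 3 4 colourings_split[of "us @ ps @ ms" "i + ins e + k" qs f q _ vs] by simp
  finally show ?thesis .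
qed

text \<open>Each rule is a property of reflections: \<open>slide_cup\<close> is reindexing,
  \<open>slide_cap\<close> and \<open>R1_cap\<close> are involutivity, \<open>R2_turned\<close> is
  injectivity with reindexing, \<open>R3\<close> is distributivity. The range hypothesis matters
  because \<open>R2\<close>, for instance, returns a colour reduced modulo \<open>q\<close> while
  the empty word returns it unchanged.\<close>

lemma colourings_local_move:
  assumes "local_move X Y" and "strands (length xs) (X @ V) n" "strands (length xs) (Y @ V) n"
    and "set xs \<subseteq> {0..<q}"
  shows "colourings q (X @ V) xs = colourings q (Y @ V) xs"
  using assms
proof (cases rule: local_move.cases)
  case (commute e i f k)
  then show ?thesis using assms colourings_commute[of i e k f xs q V] by simp
next
  case (straighten_down i)
  with assms have "i + 1 \<le> length xs" by simp
  then obtain us x vs where "xs = us @ x # vs" "length us = i" by (rule split_at1)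
  then show ?thesis using straighten_down assms(4)
    by (simp add: colourings_event colourings_event_Suc)
next
  case (straighten_up i)
  with assms have "i + 1 \<le> length xs" by simp
  then obtain us x vs where "xs = us @ x # vs" "length us = i" by (rule split_at1)
  then show ?thesis using straighten_up assms(4)
    by (simp add: colourings_event colourings_event_Suc)
next
  case (slide_cup i s)
  with assms have "i + 1 \<le> length xs" by simp
  then obtain us x vs where "xs = us @ x # vs" "length us = i" by (rule split_at1)
  then show ?thesis using slide_cup assms(4)
      sum_reflect_mod[of "\<lambda>t u. colourings q V (us @ t # x # u # vs)" x q]
    by (cases s)
      (simp_all add: colourings_event colourings_event_Suc)
next
  case (slide_cap s i)
  with assms have "i + 3 \<le> length xs" by simp
  then obtain us x y z vs where "xs = us @ x # y # z # vs" "length us = i" by (rule split_at3)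
  then show ?thesis using slide_cap assms(4) reflect_mod_eq_iff[of x q z y]
    by (cases s)
      (auto simp: colourings_event colourings_event_Suc)
next
  case (R1_cup i s)
  with assms have "i \<le> length xs" by simp
  then obtain us vs where "xs = us @ vs" "length us = i" by (rule split_at)
  then show ?thesis using R1_cup
    by (cases s) (simp_all add: colourings_event)
next
  case (R1_cap s i)
  with assms have "i + 2 \<le> length xs" by simp
  then obtain us x y vs where "xs = us @ x # y # vs" "length us = i" by (rule split_at2)
  then show ?thesis using R1_cap assms(4) reflect_mod_eq_iff[of x q y y] reflect_mod_eq_iff[of y q x x]
    by (cases s) (auto simp: colourings_event)
next
  case (R2 s i)
  with assms have "i + 2 \<le> length xs" by simp
  then obtain us x y vs where "xs = us @ x # y # vs" "length us = i" by (rule split_at2)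
  then show ?thesis using R2 assms(4)
    by (cases s) (simp_all add: colourings_event mod_simps)
next
  case (R2_turned s i)
  with assms have "i + 2 \<le> length xs" by (simp add: column_def)
  then obtain us x y vs where "xs = us @ x # y # vs" "length us = i" by (rule split_at2)
  then show ?thesis using R2_turned assms(4) reflect_mod_inject[of x q y]
      sum_reflect_mod[of "\<lambda>t u. colourings q V (us @ t # t # vs)" x q]
    by (cases s) (auto simp: column_def colourings_event colourings_event_Suc
        colourings_event_Suc2)
next
  case (R3 a b c i)
  with assms have "i + 3 \<le> length xs" by simp
  then obtain us x y z vs where "xs = us @ x # y # z # vs" "length us = i" by (rule split_at3)
  then show ?thesis using R3 assms(4)
    by (cases a; cases b; cases c) (simp_all add: colourings_event colourings_event_Suc
      reflect_mod_distrib)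
qed

text \<open>The common prefix \<open>U\<close> produces the same lists of colours on both sides, all
  of the right length and in range, so the local case applies to every summand.\<close>

lemma colourings_move_context:
  assumes "local_move X Y" and "strands (length xs) (U @ X @ V) n"
    "strands (length xs) (U @ Y @ V) n" and "set xs \<subseteq> {0..<q}"
  shows "colourings q (U @ X @ V) xs = colourings q (U @ Y @ V) xs"
  using assms(2-)
proof (induction U arbitrary: xs)
  case Nil
  then show ?case using colourings_local_move[OF assms(1)] by simp
next
  case (Cons ei U)
  obtain e i where ei: "ei = (e, i)" by fastforce
  have i: "i + ins e \<le> length xs" using Cons.prems ei by simp
  show ?case unfolding ei append_Cons colourings.simps
  proof (rule sum.cong[OF refl])
    fix ys assume ys: "ys \<in> outcomes q e (take (ins e) (drop i xs))"
    let ?xs = "take i xs @ ys @ drop (i + ins e) xs"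
    have len: "length ?xs = length xs - ins e + outs e"
      using outcomes_length[OF ys] i by simp
    have "set ys \<subseteq> {0..<q}"
      using Cons.prems(3) i set_take_subset[of "ins e" "drop i xs"] set_drop_subset[of i xs]
      by (intro outcomes_range[OF ys]) auto
    then have "set ?xs \<subseteq> {0..<q}"
      using Cons.prems(3) set_take_subset[of i xs] set_drop_subset[of "i + ins e" xs] by auto
    then show "colourings q (U @ X @ V) ?xs = colourings q (U @ Y @ V) ?xs"
      using Cons.prems(1,2) ei by (intro Cons.IH) (simp_all only: len append_Cons strands.simps)
  qed
qed

lemma colourings_isotopic:
  assumes "isotopic D E"
  shows "colourings q D [] = colourings q E []"
proof -
  have move: "colourings q D [] = colourings q E []" if "move D E" for D E
    using that
  proof cases
    case (1 X Y U V)
    then show ?thesis using colourings_move_context[of X Y "[]" U V 0 q] by simp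
  qed
  have "equivclp move D E" using assms by (simp add: isotopic_def)
  then show ?thesis
    by (induction rule: equivclp_induct) (auto dest: move)
qed


section \<open>Assignments of the free \<open>2 n\<close> knot\<close>

text \<open>The two closing caps are included, so that removing the first crossing leaves a
  \<open>row\<close> again and inductions go through.\<close>

definition row :: "bool list \<Rightarrow> diagram" where
  "row cs = map (\<lambda>c. (Cross c, 2)) cs @ [(Cap, 1), (Cap, 0)]"

definition two_diagram :: "bool \<Rightarrow> bool \<Rightarrow> bool list \<Rightarrow> diagram" where
  "two_diagram a b cs = [(Cup, 0), (Cup, 1)] @ column a b 0 @ row cs"

text \<open>The signed number of half twists of the row, counted positive when they agree with the
  bit \<open>a\<close> of the column.\<close>

definition excess :: "bool \<Rightarrow> bool list \<Rightarrow> int" where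
  "excess a cs = int (count_list cs a) - int (count_list cs (\<not> a))"

lemma row_Cons: "row (c # cs) = (Cross c, 2) # row cs"
  by (simp add: row_def)

lemma excess_simps [simp]:
  "excess a [] = 0"
  "excess a (c # cs) = excess a cs + (if c = a then 1 else -1)"
  "excess a (us @ vs) = excess a us + excess a vs"
  by (auto simp: excess_def)

lemma excess_replicate: "excess a (replicate n c) = (if c = a then int n else - int n)"
  by (induction n) auto

lemma excess_Not: "excess (\<not> a) cs = - excess a cs"
  by (simp add: excess_def)

lemma length_eq_count_list:
  fixes cs :: "bool list"
  shows "length cs = count_list cs a + count_list cs (\<not> a)"
  by (induction cs) auto

lemma two_diagram_eq_iff [simp]:
  "two_diagram a b cs = two_diagram a' b' cs' \<longleftrightarrow> a = a' \<and> b = b' \<and> cs = cs'"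
proof -
  have "inj (map (\<lambda>c. (Cross c :: bool event, 2 :: nat)))"
    by (intro inj_mapI injI) auto
  then show ?thesis
    by (auto simp: two_diagram_def column_def row_def dest: injD)
qed

lemma map_event_eq_Cross: "map_event f e = Cross x \<longleftrightarrow> (\<exists>y. e = Cross y \<and> f y = x)"
  by (cases e) auto

lemma map_event_eq_Cup [simp]: "map_event f e = Cup \<longleftrightarrow> e = Cup"
  by (cases e) auto

lemma map_event_eq_Cap [simp]: "map_event f e = Cap \<longleftrightarrow> e = Cap"
  by (cases e) auto

lemma shadow_eq_replicate:
  "shadow D = replicate n (Cross (), i) \<Longrightarrow>
    \<exists>cs. length cs = n \<and> D = map (\<lambda>c. (Cross c, i)) cs"
proof (induction n arbitrary: D)
  case 0
  then show ?case by (simp add: shadow_def)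
next
  case (Suc n)
  then obtain c D' where D: "D = (Cross c, i) # D'" and "shadow D' = replicate n (Cross (), i)"
    by (auto simp: shadow_def map_eq_Cons_conv map_event_eq_Cross)
  then obtain cs where "length cs = n" "D' = map (\<lambda>c. (Cross c, i)) cs"
    using Suc.IH by blast
  then show ?case using D by (intro exI[of _ "c # cs"]) simp
qed

lemma assignments_free_two:
  "assignments (free_two n) = {two_diagram a b cs | a b cs. length cs = n}"
proof (intro equalityI subsetI)
  fix D assume "D \<in> assignments (free_two n)"
  then obtain a b E where D: "D = [(Cup, 0), (Cup, 1)] @ column a b 0 @ E @ [(Cap, 1), (Cap, 0)]"
    and E: "shadow E = replicate n (Cross (), 2)"
    by (auto simp: assignments_def free_two_def column_def shadow_def map_eq_Cons_conv
        map_eq_append_conv map_event_eq_Cross eq_commute[of "replicate n _"] eq_commute[of Cap])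
  then show "D \<in> {two_diagram a b cs | a b cs. length cs = n}"
    using shadow_eq_replicate[OF E] by (auto simp: two_diagram_def row_def)
next
  fix D assume "D \<in> {two_diagram a b cs | a b cs. length cs = n}"
  then show "D \<in> assignments (free_two n)"
    by (auto simp: assignments_def free_two_def column_def shadow_def two_diagram_def row_def
        map_replicate_const comp_def)
qed

lemma mirror_two_diagram: "mirror (two_diagram a b cs) = two_diagram (\<not> a) (\<not> b) (map Not cs)"
  by (simp add: mirror_def two_diagram_def column_def row_def)

lemma column_cancels_two_diagram: "column_cancels (two_diagram a b cs) \<longleftrightarrow> a \<noteq> b"
  by (auto simp: column_cancels_def two_diagram_def column_def)


section \<open>Colourings of the assignments\<close>

lemma mod_eqI:
  fixes q :: int
  shows "A = B + q * C \<Longrightarrow> A mod q = B mod q"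
  by simp

text \<open>A crossing with bit \<open>True\<close> adds \<open>x - y\<close> to both colours, one
  with bit \<open>False\<close> subtracts it, and both preserve the difference. The whole row thus
  adds the excess times \<open>x - y\<close>, and the caps compare the result with \<open>v\<close>
  and \<open>u\<close>.\<close>

lemma colourings_row:
  assumes "x \<in> {0..<q}" "y \<in> {0..<q}"
  shows "colourings q (row cs) [u, v, x, y] =
    (if v = (x + excess True cs * (x - y)) mod q \<and> u = (y + excess True cs * (x - y)) mod q
     then 1 else 0)"
  using assms
proof (induction cs arbitrary: x y)
  case Nil
  then show ?case by (auto simp: row_def colourings.simps)
next
  case (Cons c cs)
  let ?w = "excess True cs"
  have q: "q > 0" using Cons.prems by simp
  show ?case
  proof (cases c)
    case True
    \<comment> \<open>Keeping the quotient \<open>k\<close> of the reduction explicit shows that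
      both sides differ by a multiple of \<open>q\<close>.\<close>
    define X where "X = (2 * x - y) mod q"
    define k where "k = (2 * x - y) div q"
    have X: "X = 2 * x - y - q * k"
      by (simp add: X_def k_def minus_mult_div_eq_mod)
    have "colourings q (row (c # cs)) [u, v, x, y] = colourings q (row cs) [u, v, X, x]"
      using True by (simp add: row_Cons colourings.simps X_def)
    also have "\<dots> = (if v = (X + ?w * (X - x)) mod q \<and> u = (x + ?w * (X - x)) mod q then 1 else 0)"
      using q Cons.prems by (intro Cons.IH) (simp_all add: X_def)
    also have "(X + ?w * (X - x)) mod q = (x + (?w + 1) * (x - y)) mod q"
      by (rule mod_eqI[where C = "- k * (1 + ?w)"]) (simp add: X algebra_simps)
    also have "(x + ?w * (X - x)) mod q = (y + (?w + 1) * (x - y)) mod q"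
      by (rule mod_eqI[where C = "- k * ?w"]) (simp add: X algebra_simps)
    finally show ?thesis using True by simp
  next
    case False
    define Y where "Y = (2 * y - x) mod q"
    define k where "k = (2 * y - x) div q"
    have Y: "Y = 2 * y - x - q * k"
      by (simp add: Y_def k_def minus_mult_div_eq_mod)
    have "colourings q (row (c # cs)) [u, v, x, y] = colourings q (row cs) [u, v, y, Y]"
      using False by (simp add: row_Cons colourings.simps Y_def)
    also have "\<dots> = (if v = (y + ?w * (y - Y)) mod q \<and> u = (Y + ?w * (y - Y)) mod q then 1 else 0)"
      using q Cons.prems by (intro Cons.IH) (simp_all add: Y_def)
    also have "(y + ?w * (y - Y)) mod q = (x + (?w - 1) * (x - y)) mod q"
      by (rule mod_eqI[where C = "k * ?w"]) (simp add: Y algebra_simps)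
    also have "(Y + ?w * (y - Y)) mod q = (y + (?w - 1) * (x - y)) mod q"
      by (rule mod_eqI[where C = "k * (?w - 1)"]) (simp add: Y algebra_simps)
    finally show ?thesis using False by simp
  qed
qed

lemma colourings_top:
  "colourings q ((Cup, 0) # D) xs = (\<Sum>t \<in> {0..<q}. colourings q D (t # t # xs))"
  "colourings q ((Cup, 1) # D) (x # xs) = (\<Sum>t \<in> {0..<q}. colourings q D (x # t # t # xs))"
  "colourings q ((Cap, 1) # D) (x # y # z # xs) = (if y = z then colourings q D (x # xs) else 0)"
  "colourings q ((Cross s, 0) # D) (x # y # xs) = colourings q D (crossing q s x y @ xs)"
  "colourings q ((Cross s, 2) # D) (x # y # z # t # xs) =
    colourings q D (x # y # crossing q s z t @ xs)"
  using colourings_Cup[of "[]" 0 q D xs] colourings_Cup[of "[x]" 1 q D xs]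
    colourings_Cap[of "[x]" 1 q D y z xs] colourings_Cross[of "[]" 0 q s D x y xs]
    colourings_Cross[of "[x, y]" 2 q s D z t xs]
  by simp_all

text \<open>Here \<open>x\<close>, \<open>y\<close>, \<open>z\<close> colour the outer arc, the
  inner arc and the left arc of the column; \<open>v = v'\<close> is the condition at the right arc
  of the column.\<close>

lemma colourings_two_diagram:
  "colourings q (two_diagram a b cs) [] =
    (\<Sum>x \<in> {0..<q}. \<Sum>y \<in> {0..<q}. \<Sum>z \<in> {0..<q}.
      case crossing q a x z @ crossing q b z y of [u, v, v', t] \<Rightarrow>
        (if v = v' then colourings q (row cs) [u, t, y, x] else 0))"
  unfolding two_diagram_def column_def
  by (cases a; cases b)
    (simp_all only: colourings_top crossing.simps append.simps list.case add_0 add_0_right)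

lemma mod_eq_iff_dvd_range:
  fixes x :: int
  assumes "x \<in> {0..<q}"
  shows "x = y mod q \<longleftrightarrow> q dvd x - y"
  using assms mod_eq_dvd_iff[of x q y] by simp

text \<open>The right arc of the column gives y = 2z - x, hence y - x = 2(z - x) modulo
  \<open>q\<close>. Both closing conditions of the row then become divisibility of (2w + 1)(z - x),
  with w negated for bit \<open>False\<close>. This is where the determinant appears.\<close>

lemma colouring_conditions:
  fixes q w :: int
  assumes "x \<in> {0..<q}" "y \<in> {0..<q}" "z \<in> {0..<q}"
  shows "(2 * z - y) mod q = x \<and> z = (y + w * (y - x)) mod q
      \<and> (2 * x - z) mod q = (x + w * (y - x)) mod q
    \<longleftrightarrow> y = (2 * z - x) mod q \<and> q dvd (2 * w + 1) * (z - x)" (is ?A)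
    and "(2 * z - x) mod q = y \<and> (2 * y - z) mod q = (y + w * (y - x)) mod q
      \<and> z = (x + w * (y - x)) mod q
    \<longleftrightarrow> y = (2 * z - x) mod q \<and> q dvd (2 * (- w) + 1) * (z - x)" (is ?B)
proof -
  have *: "(2 * z - y) mod q = x \<longleftrightarrow> y = (2 * z - x) mod q"
    using reflect_mod_eq_iff[OF assms(2,1), of z] by auto
  have "(q dvd z - (y + w * (y - x)) \<longleftrightarrow> q dvd (2 * w + 1) * (z - x)) \<and>
    (q dvd 2 * x - z - (x + w * (y - x)) \<longleftrightarrow> q dvd (2 * w + 1) * (z - x)) \<and>
    (q dvd 2 * y - z - (y + w * (y - x)) \<longleftrightarrow> q dvd (2 * (- w) + 1) * (z - x)) \<and>
    (q dvd z - (x + w * (y - x)) \<longleftrightarrow> q dvd (2 * (- w) + 1) * (z - x))"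
    if y: "y = (2 * z - x) mod q"
  proof -
    define k where "k = - ((2 * z - x) div q)"
    have k: "y = 2 * z - x + q * k"
      using y by (simp add: k_def minus_mult_div_eq_mod)
    have "z - (y + w * (y - x)) = - ((2 * w + 1) * (z - x)) + q * (- k * (1 + w))"
      "2 * x - z - (x + w * (y - x)) = - ((2 * w + 1) * (z - x)) + q * (- k * w)"
      "2 * y - z - (y + w * (y - x)) = (2 * (- w) + 1) * (z - x) + q * (k * (1 - w))"
      "z - (x + w * (y - x)) = (2 * (- w) + 1) * (z - x) + q * (- k * w)"
      unfolding k by (simp_all add: algebra_simps)
    moreover have "q dvd c + q * d \<longleftrightarrow> q dvd c" for c d
      by (rule dvd_add_left_iff) simp
    ultimately show ?thesis by (simp only: dvd_minus_iff)
  qed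
  then show ?A ?B
    using * by (auto simp: mod_eq_iff_dvd_range[OF assms(3)] mod_eq_dvd_iff)
qed

text \<open>The colour \<open>y\<close> is determined by \<open>x\<close> and \<open>z\<close>, so
  its sum collapses.\<close>

lemma sum_middle_delta:
  fixes q :: int and P :: "int \<Rightarrow> int \<Rightarrow> bool"
  assumes "q > 0"
  shows "(\<Sum>x \<in> {0..<q}. \<Sum>y \<in> {0..<q}. \<Sum>z \<in> {0..<q}.
      if y = f x z mod q \<and> P x z then 1 else 0) =
    (\<Sum>x \<in> {0..<q}. \<Sum>z \<in> {0..<q}. if P x z then 1 else (0 :: nat))"
proof (rule sum.cong[OF refl])
  fix x
  have "(\<Sum>y \<in> {0..<q}. \<Sum>z \<in> {0..<q}. if y = f x z mod q \<and> P x z then 1 else 0) =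
    (\<Sum>z \<in> {0..<q}. \<Sum>y \<in> {0..<q}. if y = f x z mod q then (if P x z then 1 else 0) else (0::nat))"
    by (subst sum.swap) (intro sum.cong refl, simp)
  also have "\<dots> = (\<Sum>z \<in> {0..<q}. if P x z then 1 else 0)"
    using assms by simp
  finally show "(\<Sum>y \<in> {0..<q}. \<Sum>z \<in> {0..<q}. if y = f x z mod q \<and> P x z then 1 else 0) =
    (\<Sum>z \<in> {0..<q}. if P x z then 1 else (0::nat))" .
qed

lemma colourings_twisted_column:
  assumes "q > 0"
  shows "colourings q (two_diagram a a cs) [] =
    (\<Sum>x \<in> {0..<q}. \<Sum>z \<in> {0..<q}. if q dvd (2 * excess a cs + 1) * (z - x) then 1 else 0)"
proof -
  have "colourings q (two_diagram a a cs) [] =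
    (\<Sum>x \<in> {0..<q}. \<Sum>y \<in> {0..<q}. \<Sum>z \<in> {0..<q}.
      if y = (2 * z - x) mod q \<and> q dvd (2 * excess a cs + 1) * (z - x) then 1 else 0)"
    unfolding colourings_two_diagram
  proof (intro sum.cong refl)
    fix x y z assume r: "x \<in> {0..<q}" "y \<in> {0..<q}" "z \<in> {0..<q}"
    let ?l = "case crossing q a x z @ crossing q a z y of [u, v, v', t] \<Rightarrow>
        (if v = v' then colourings q (row cs) [u, t, y, x] else 0)"
    let ?r = "if y = (2 * z - x) mod q \<and> q dvd (2 * excess a cs + 1) * (z - x) then 1 else (0 :: nat)"
    let ?w = "excess True cs"
    show "?l = ?r"
    proof (cases a)
      case True
      then have "?l = (if x = (2 * z - y) mod q
          then colourings q (row cs) [(2 * x - z) mod q, z, y, x] else 0)"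
        by simp
      also have "\<dots> = (if (2 * z - y) mod q = x \<and> z = (y + ?w * (y - x)) mod q
          \<and> (2 * x - z) mod q = (x + ?w * (y - x)) mod q then 1 else 0)"
        unfolding colourings_row[OF r(2,1)] by auto
      finally have "?l = \<dots>" .
      then show ?thesis unfolding colouring_conditions(1)[OF r] using True by simp
    next
      case False
      then have "?l = (if (2 * z - x) mod q = y
          then colourings q (row cs) [z, (2 * y - z) mod q, y, x] else 0)"
        by simp
      also have "\<dots> = (if (2 * z - x) mod q = y \<and> (2 * y - z) mod q = (y + ?w * (y - x)) mod q
          \<and> z = (x + ?w * (y - x)) mod q then 1 else 0)"
        unfolding colourings_row[OF r(2,1)] by auto
      finally have "?l = \<dots>" .
      \<comment> \<open>\<open>colourings_row\<close> uses the excess of \<open>True\<close>;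
        passing to the excess of \<open>a\<close>, which is \<open>False\<close> here, changes the
        sign.\<close>
      then show ?thesis unfolding colouring_conditions(2)[OF r]
        using False excess_Not[of True cs] by simp
    qed
  qed
  then show ?thesis
    using sum_middle_delta[OF assms, of "\<lambda>x z. 2 * z - x"] by simp
qed

text \<open>The right arc of the column forces \<open>x = y\<close>; the row then changes no colour
  and closing forces \<open>z = x\<close>. Only the constant colourings remain, whatever the row
  is.\<close>

lemma colourings_cancelling_column:
  assumes "a \<noteq> b"
  shows "colourings q (two_diagram a b cs) [] = nat q"
proof -
  have "colourings q (two_diagram a b cs) [] =
    (\<Sum>x \<in> {0..<q}. \<Sum>y \<in> {0..<q}. if x = y then (\<Sum>z \<in> {0..<q}. if x = z then 1 else 0) else 0)"
    unfolding colourings_two_diagram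
  proof (intro sum.cong refl)
    fix x y assume r: "x \<in> {0..<q}" "y \<in> {0..<q}"
    have "(case crossing q a x z @ crossing q b z y of [u, v, v', t] \<Rightarrow>
        (if v = v' then colourings q (row cs) [u, t, y, x] else 0)) =
      (if x = y then if x = z then 1 else 0 else 0)" if z: "z \<in> {0..<q}" for z
    proof (cases a)
      case True
      have "(2 * x - z) mod q = x \<longleftrightarrow> x = z"
        using reflect_mod_eq_iff[OF z r(1), of x] r by auto
      moreover have "colourings q (row cs) [(2 * x - z) mod q, (2 * y - z) mod q, y, x] =
          (if x = z then 1 else 0)" if "x = y"
        unfolding colourings_row[OF r(2,1)] using that calculation r by auto
      ultimately show ?thesis using assms True by auto
    next
      case False
      have "(2 * z - x) mod q = (2 * z - y) mod q \<longleftrightarrow> x = y"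
        by (rule reflect_mod_inject[OF r])
      moreover have "colourings q (row cs) [z, z, y, x] = (if x = z then 1 else 0)" if "x = y"
        unfolding colourings_row[OF r(2,1)] using that r by auto
      ultimately show ?thesis using assms False by auto
    qed
    then show "(\<Sum>z \<in> {0..<q}. case crossing q a x z @ crossing q b z y of [u, v, v', t] \<Rightarrow>
        (if v = v' then colourings q (row cs) [u, t, y, x] else 0)) =
      (if x = y then (\<Sum>z \<in> {0..<q}. if x = z then 1 else 0) else 0)"
      by simp
  qed
  also have "\<dots> = nat q" by simp
  finally show ?thesis .
qed

lemma colourings_unknot: "colourings q unknot [] = nat q"
  by (simp add: unknot_def colourings.simps sum_outcomes_Cup del: outcomes.simps(1))

text \<open>The count is \<open>q\<close> times the gcd of \<open>q\<close> and the determinant.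
  Asking only when the maximum is attained, that is, when all pairs \<open>(x, z)\<close> are
  admissible, avoids computing the gcd.\<close>

lemma all_colourings_iff_dvd:
  assumes "q \<ge> 2"
  shows "colourings q (two_diagram a a cs) [] = (nat q)\<^sup>2 \<longleftrightarrow> q dvd 2 * excess a cs + 1"
proof -
  let ?S = "{0..<q} \<times> {0..<q}" and ?v = "2 * excess a cs + 1"
  let ?T = "{p \<in> ?S. q dvd ?v * (snd p - fst p)}"
  have "colourings q (two_diagram a a cs) [] =
      (\<Sum>p \<in> ?S. if q dvd ?v * (snd p - fst p) then 1 else 0)"
    using assms by (simp add: colourings_twisted_column sum.cartesian_product split_def)
  also have "\<dots> = card ?T"
    by (subst sum.inter_filter[symmetric]) simp_all
  finally have "colourings q (two_diagram a a cs) [] = card ?T" .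
  moreover have "card ?S = (nat q)\<^sup>2" by (simp add: power2_eq_square)
  moreover have "card ?T = card ?S \<longleftrightarrow> ?T = ?S"
    using card_subset_eq[of ?S ?T] by auto
  moreover have "?T = ?S \<longleftrightarrow> q dvd ?v"
  proof
    assume "?T = ?S"
    \<comment> \<open>The pair with difference 1 tests the divisibility; it is in range because
      \<open>q\<close> is at least 2.\<close>
    moreover have "(0, 1) \<in> ?S" using assms by simp
    ultimately have "(0, 1) \<in> ?T" by blast
    then show "q dvd ?v" by simp
  qed auto
  ultimately show ?thesis by simp
qed


section \<open>Alternating assignments\<close>

lemma alt_labels_CupD:
  "alt_labels xs ((Cup, i) # D) ys \<Longrightarrow>
    \<exists>t. alt_labels (take i xs @ [t, \<not> t] @ drop i xs) D ys"
  by (erule alt_labels.cases) auto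

lemma alt_labels_CapD:
  "alt_labels xs ((Cap, i) # D) ys \<Longrightarrow>
    xs ! Suc i = (\<not> xs ! i) \<and> alt_labels (take i xs @ drop (i + 2) xs) D ys"
  by (erule alt_labels.cases) (auto simp: nth_append)

lemma alt_labels_CrossD:
  "alt_labels xs ((Cross s, i) # D) ys \<Longrightarrow>
    xs ! i = s \<and> xs ! Suc i = (\<not> s) \<and> alt_labels xs D ys"
  by (erule alt_labels.cases) (auto simp: nth_append)

text \<open>A crossing leaves the labels unchanged, and its bit is the label of its upper strand;
  hence all crossings on the same two levels have equal bits.\<close>

lemma alt_labels_row: "alt_labels xs (row cs) ys \<Longrightarrow> set cs \<subseteq> {xs ! 2}"
  by (induction cs) (auto simp: row_Cons dest!: alt_labels_CrossD)

text \<open>The two ends of the left arc of the column have opposite labels, which links the two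
  column bits; the inner arc links the lower column crossing to the row in the same way.\<close>

lemma alternating_two_diagram:
  assumes "alternating (two_diagram a b cs)"
  shows "b = a \<and> set cs \<subseteq> {a}"
proof -
  obtain t where "alt_labels [t, \<not> t] ((Cup, 1) # column a b 0 @ row cs) []"
    using assms by (auto simp: alternating_def two_diagram_def dest: alt_labels_CupD)
  then obtain u where "alt_labels [t, u, \<not> u, \<not> t] (column a b 0 @ row cs) []"
    by (auto dest: alt_labels_CupD)
  then obtain v where
    "alt_labels [t, v, \<not> v, u, \<not> u, \<not> t] ((Cross a, 0) # (Cross b, 2) # (Cap, 1) # row cs) []"
    by (auto simp: column_def numeral_2_eq_2 dest!: alt_labels_CupD)
  then show ?thesis
    by (auto dest!: alt_labels_CrossD alt_labels_CapD alt_labels_row)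
qed


section \<open>Isotopies of the assignments\<close>

lemma isotopic_refl [simp]: "isotopic D D"
  by (simp add: isotopic_def)

lemma isotopic_sym: "isotopic D E \<Longrightarrow> isotopic E D"
  unfolding isotopic_def by (rule equivclp_sym)

lemma isotopic_trans [trans]: "isotopic D E \<Longrightarrow> isotopic E F \<Longrightarrow> isotopic D F"
  unfolding isotopic_def by (rule equivclp_trans)

lemma isotopicI:
  assumes "local_move X Y" "D = U @ X @ V" "E = U @ Y @ V" "closed_picture D" "closed_picture E"
  shows "isotopic D E"
  using move.intros[of X Y U V] assms by (auto simp: isotopic_def)

lemmas isotopicI' = isotopicI[THEN isotopic_sym]

lemma strands_row [simp]: "strands (Suc (Suc (Suc (Suc 0)))) (row cs) 0"
  by (induction cs) (simp_all add: row_def numeral_eq_Suc)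

lemma closed_two_diagram: "closed_picture (two_diagram a b cs)"
  by (simp add: two_diagram_def column_def numeral_eq_Suc)

section \<open>Reducing the row by second Reidemeister moves\<close>

lemma isotopic_row_cancel:
  "isotopic (two_diagram a b (us @ s # (\<not> s) # vs)) (two_diagram a b (us @ vs))"
  by (rule isotopicI[OF R2[of s 2], where
        U = "[(Cup, 0), (Cup, 1)] @ column a b 0 @ map (\<lambda>c. (Cross c, 2)) us" and V = "row vs"])
    (simp_all only: closed_two_diagram, simp_all add: two_diagram_def row_def)

text \<open>Ensures that cancelling neighbours can stop only at a constant row.\<close>

lemma constant_or_adjacent_change:
  "(\<exists>c. cs = replicate (length cs) c) \<or> (\<exists>us s vs. cs = us @ s # (\<not> s) # vs)"
proof (induction cs)
  case (Cons c cs)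
  show ?case
  proof (cases cs)
    case Nil
    then show ?thesis by auto
  next
    case (Cons d ds)
    show ?thesis
    proof (cases "d = c")
      case True
      show ?thesis using Cons.IH
      proof
        assume "\<exists>e. cs = replicate (length cs) e"
        then obtain e where "cs = replicate (length cs) e" ..
        moreover from this Cons True have "e = c" by simp
        ultimately have "c # cs = replicate (length (c # cs)) c" by simp
        then show ?thesis by blast
      next
        assume "\<exists>us s vs. cs = us @ s # (\<not> s) # vs"
        then obtain us s vs where "cs = us @ s # (\<not> s) # vs" by blast
        then have "c # cs = (c # us) @ s # (\<not> s) # vs" by simp
        then show ?thesis by blast
      qed
    next
      case False
      then have "c # cs = [] @ c # (\<not> c) # ds" using Cons by simp
      then show ?thesis by blast
    qed
  qed
qed simp

text \<open>Each cancellation removes one crossing of either bit, so it shortens the row and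
  preserves the excess.\<close>

lemma isotopic_constant_row:
  "\<exists>m c. isotopic (two_diagram a b cs) (two_diagram a b (replicate m c)) \<and>
    excess True (replicate m c) = excess True cs"
proof (induction cs rule: length_induct)
  case (1 cs)
  consider c where "cs = replicate (length cs) c"
    | us s vs where "cs = us @ s # (\<not> s) # vs"
    using constant_or_adjacent_change[of cs] by blast
  then show ?case
  proof cases
    case 1
    then show ?thesis by (metis isotopic_refl)
  next
    case (2 us s vs)
    then obtain m c where
      "isotopic (two_diagram a b (us @ vs)) (two_diagram a b (replicate m c))"
      "excess True (replicate m c) = excess True (us @ vs)"
      using 1 by (metis add_Suc_right length_Cons length_append less_Suc_eq)
    moreover have "excess True cs = excess True (us @ vs)" using 2 by auto
    ultimately show ?thesis
      using 2 isotopic_row_cancel isotopic_trans by metis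
  qed
qed

lemma isotopic_row_excess:
  assumes "excess c cs = int m"
  shows "isotopic (two_diagram a b cs) (two_diagram a b (replicate m c))"
proof -
  obtain l d where "isotopic (two_diagram a b cs) (two_diagram a b (replicate l d))"
    and "excess True (replicate l d) = excess True cs"
    using isotopic_constant_row by blast
  \<comment> \<open>The excess determines length and bit, except that for \<open>m = 0\<close> the
    bits may differ; then both lists are empty.\<close>
  moreover from this have "replicate l d = replicate m c"
    using assms excess_Not[of True cs] by (cases c; cases d) (auto simp: excess_replicate)
  ultimately show ?thesis by simp
qed

text \<open>The row crossing commutes with the column and is turned past both left arcs, onto the two strands
  entering the column, where \<open>R3\<close> turns it into a kink.\<close>

lemma isotopic_flype:
  "isotopic (two_diagram a a ((\<not> a) # cs)) (two_diagram (\<not> a) (\<not> a) cs)"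
proof -
  define s where "s = (\<not> a)"
  let ?R = "row cs"
  note [simp] = numeral_eq_Suc s_def
  have "isotopic ([(Cup, 0), (Cup, 1), (Cup, 1), (Cross a, 0), (Cross a, 2), (Cap, 1), (Cross s, 2)] @ ?R)
      ([(Cup, 0), (Cup, 1), (Cup, 1), (Cross a, 0), (Cross a, 2), (Cross s, 4), (Cap, 1)] @ ?R)"
    by (rule isotopicI[OF commute[of Cap 1 "Cross s" 1], where
          U = "[(Cup, 0), (Cup, 1), (Cup, 1), (Cross a, 0), (Cross a, 2)]" and V = ?R]) simp_all
  also have "isotopic \<dots>
      ([(Cup, 0), (Cup, 1), (Cup, 1), (Cross a, 0), (Cross s, 4), (Cross a, 2), (Cap, 1)] @ ?R)"
    by (rule isotopicI[OF commute[of "Cross a" 2 "Cross s" 0], where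
          U = "[(Cup, 0), (Cup, 1), (Cup, 1), (Cross a, 0)]" and V = "(Cap, 1) # ?R"]) simp_all
  also have "isotopic \<dots>
      ([(Cup, 0), (Cup, 1), (Cup, 1), (Cross s, 4), (Cross a, 0), (Cross a, 2), (Cap, 1)] @ ?R)"
    by (rule isotopicI[OF commute[of "Cross a" 0 "Cross s" 2], where
          U = "[(Cup, 0), (Cup, 1), (Cup, 1)]" and V = "[(Cross a, 2), (Cap, 1)] @ ?R"]) simp_all
  also have "isotopic \<dots>
      ([(Cup, 0), (Cup, 1), (Cross s, 2), (Cup, 1), (Cross a, 0), (Cross a, 2), (Cap, 1)] @ ?R)"
    by (rule isotopicI[OF commute[of Cup 1 "Cross s" 1], where
          U = "[(Cup, 0), (Cup, 1)]" and V = "[(Cross a, 0), (Cross a, 2), (Cap, 1)] @ ?R"]) simp_all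
  \<comment> \<open>Each turn past an arc negates the bit: \<open>s\<close> becomes \<open>a\<close>
    at the inner arc and \<open>s\<close> again at the outer one.\<close>
  also have "isotopic \<dots>
      ([(Cup, 0), (Cup, 2), (Cross a, 1), (Cup, 1), (Cross a, 0), (Cross a, 2), (Cap, 1)] @ ?R)"
    by (rule isotopicI'[OF slide_cup[of 1 a], where
          U = "[(Cup, 0)]" and V = "[(Cup, 1), (Cross a, 0), (Cross a, 2), (Cap, 1)] @ ?R"]) simp_all
  \<comment> \<open>The two arcs now lie side by side; exchanging their births puts the outer one
    next to the crossing.\<close>
  also have "isotopic \<dots>
      ([(Cup, 0), (Cup, 0), (Cross a, 1), (Cup, 1), (Cross a, 0), (Cross a, 2), (Cap, 1)] @ ?R)"
    by (rule isotopicI[OF commute[of Cup 0 Cup 0], where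
          U = "[]" and V = "[(Cross a, 1), (Cup, 1), (Cross a, 0), (Cross a, 2), (Cap, 1)] @ ?R"])
      simp_all
  also have "isotopic \<dots>
      ([(Cup, 0), (Cup, 1), (Cross s, 0), (Cup, 1), (Cross a, 0), (Cross a, 2), (Cap, 1)] @ ?R)"
    by (rule isotopicI'[OF slide_cup[of 0 s], where
          U = "[(Cup, 0)]" and V = "[(Cup, 1), (Cross a, 0), (Cross a, 2), (Cap, 1)] @ ?R"]) simp_all
  \<comment> \<open>The upper crossing of the column is turned past its left arc to prepare the
    three crossings for \<open>R3\<close>; the last step turns it back.\<close>
  also have "isotopic \<dots>
      ([(Cup, 0), (Cup, 1), (Cross s, 0), (Cup, 0), (Cross s, 1), (Cross a, 2), (Cap, 1)] @ ?R)"
    by (rule isotopicI[OF slide_cup[of 0 a], where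
          U = "[(Cup, 0), (Cup, 1), (Cross s, 0)]" and V = "[(Cross a, 2), (Cap, 1)] @ ?R"]) simp_all
  also have "isotopic \<dots>
      ([(Cup, 0), (Cup, 1), (Cup, 0), (Cross s, 2), (Cross s, 1), (Cross a, 2), (Cap, 1)] @ ?R)"
    by (rule isotopicI'[OF commute[of Cup 0 "Cross s" 0], where
          U = "[(Cup, 0), (Cup, 1)]" and V = "[(Cross s, 1), (Cross a, 2), (Cap, 1)] @ ?R"]) simp_all
  \<comment> \<open>\<open>R3\<close> read backwards; the last two of its bits \<open>a\<close>,
    \<open>s\<close>, \<open>s\<close> agree, which is its side condition and uses that the row
    crossing is opposite to the column.\<close>
  also have "isotopic \<dots>
      ([(Cup, 0), (Cup, 1), (Cup, 0), (Cross a, 1), (Cross s, 2), (Cross s, 1), (Cap, 1)] @ ?R)"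
    by (rule isotopicI'[OF R3[of a s s 1], where
          U = "[(Cup, 0), (Cup, 1), (Cup, 0)]" and V = "(Cap, 1) # ?R"]) simp_all
  also have "isotopic \<dots>
      ([(Cup, 0), (Cup, 1), (Cup, 0), (Cross a, 1), (Cross s, 2), (Cap, 1)] @ ?R)"
    by (rule isotopicI[OF R1_cap[of s 1], where
          U = "[(Cup, 0), (Cup, 1), (Cup, 0), (Cross a, 1), (Cross s, 2)]" and V = ?R]) simp_all
  also have "isotopic \<dots>
      ([(Cup, 0), (Cup, 1), (Cup, 1), (Cross s, 0), (Cross s, 2), (Cap, 1)] @ ?R)"
    by (rule isotopicI'[OF slide_cup[of 0 s], where
          U = "[(Cup, 0), (Cup, 1)]" and V = "[(Cross s, 2), (Cap, 1)] @ ?R"]) simp_all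
  finally show ?thesis
    by (simp add: two_diagram_def column_def row_Cons)
qed

text \<open>Without a row, first the lower and then the upper crossing of the column, turned past a
  left arc, becomes a kink at a right turning point.\<close>

lemma isotopic_unknot: "isotopic (two_diagram c c []) unknot"
proof -
  note [simp] = numeral_eq_Suc
  let ?U = "[(Cup, 0), (Cup, 1), (Cross c, 0)] :: diagram"
  have "isotopic (two_diagram c c [])
      ([(Cup, 0), (Cup, 1), (Cup, 3), (Cross c, 0), (Cross c, 2), (Cap, 1), (Cap, 1), (Cap, 0)])"
    by (rule isotopicI'[OF commute[of Cup 1 Cup 0], where U = "[(Cup, 0)]" and
          V = "[(Cross c, 0), (Cross c, 2), (Cap, 1), (Cap, 1), (Cap, 0)]"])
      (simp_all add: two_diagram_def column_def row_def)
  also have "isotopic \<dots> (?U @ [(Cup, 3), (Cross c, 2), (Cap, 1), (Cap, 1), (Cap, 0)])"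
    by (rule isotopicI'[OF commute[of "Cross c" 0 Cup 1], where U = "[(Cup, 0), (Cup, 1)]" and
          V = "[(Cross c, 2), (Cap, 1), (Cap, 1), (Cap, 0)]"]) simp_all
  also have "isotopic \<dots> (?U @ [(Cup, 3), (Cross c, 2), (Cap, 3), (Cap, 1), (Cap, 0)])"
    by (rule isotopicI[OF commute[of Cap 1 Cap 0], where U = "?U @ [(Cup, 3), (Cross c, 2)]" and
          V = "[(Cap, 0)]"]) simp_all
  also have "isotopic \<dots> (?U @ [(Cup, 2), (Cross (\<not> c), 3), (Cap, 3), (Cap, 1), (Cap, 0)])"
    by (rule isotopicI[OF slide_cup[of 2 c], where U = ?U and
          V = "[(Cap, 3), (Cap, 1), (Cap, 0)]"]) simp_all
  also have "isotopic \<dots> (?U @ [(Cup, 2), (Cap, 3), (Cap, 1), (Cap, 0)])"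
    by (rule isotopicI[OF R1_cap[of "\<not> c" 3], where U = "?U @ [(Cup, 2)]" and
          V = "[(Cap, 1), (Cap, 0)]"]) simp_all
  also have "isotopic \<dots> (?U @ [(Cap, 1), (Cap, 0)])"
    by (rule isotopicI[OF straighten_down[of 2], where U = ?U and V = "[(Cap, 1), (Cap, 0)]"])
      simp_all
  also have "isotopic \<dots> [(Cup, 0), (Cup, 0), (Cross (\<not> c), 1), (Cap, 1), (Cap, 0)]"
    by (rule isotopicI[OF slide_cup[of 0 c], where U = "[(Cup, 0)]" and V = "[(Cap, 1), (Cap, 0)]"])
      simp_all
  also have "isotopic \<dots> [(Cup, 0), (Cup, 0), (Cap, 1), (Cap, 0)]"
    by (rule isotopicI[OF R1_cap[of "\<not> c" 1], where U = "[(Cup, 0), (Cup, 0)]" and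
          V = "[(Cap, 0)]"]) simp_all
  also have "isotopic \<dots> unknot"
    by (rule isotopicI[OF straighten_down[of 0], where U = "[(Cup, 0)]" and V = "[(Cap, 0)]"])
      (simp_all add: unknot_def)
  finally show ?thesis .
qed


section \<open>Recognising the \<open>2 k\<close> knot\<close>

text \<open>The existential in \<open>is_two_knot\<close> therefore ranges over at most two
  diagrams, which are mirror images of each other.\<close>

lemma two_knot_diagram:
  assumes "E \<in> assignments (free_two m)" "alternating E"
  obtains a where "E = two_diagram a a (replicate m a)"
    and "mirror E = two_diagram (\<not> a) (\<not> a) (replicate m (\<not> a))"
proof -
  obtain a b cs where E: "E = two_diagram a b cs" "length cs = m"
    using assms(1) by (auto simp: assignments_free_two)
  with assms(2) have "b = a" "set cs \<subseteq> {a}" using alternating_two_diagram by auto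
  moreover from this have "cs = replicate m a"
    using E(2) by (metis replicate_eqI singletonD subsetD)
  ultimately show thesis using that E by (simp add: mirror_two_diagram)
qed

lemma same_knot_trans_isotopic: "isotopic D E \<Longrightarrow> same_knot E F \<Longrightarrow> same_knot D F"
  unfolding same_knot_def using isotopic_trans by blast

lemma is_two_knot_isotopic: "isotopic D E \<Longrightarrow> is_two_knot m E \<Longrightarrow> is_two_knot m D"
  by (cases m) (auto intro: same_knot_trans_isotopic)

text \<open>The diagrams for the two values of \<open>a\<close> are mirror images, so whichever of
  them the known alternating assignment is, \<open>same_knot\<close> covers both.\<close>

lemma is_two_knot_alternating: "is_two_knot m (two_diagram a a (replicate m a))"
proof (cases m)
  case 0
  then show ?thesis using isotopic_unknot by (simp add: same_knot_def)
next
  case (Suc l)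
  obtain E where E: "E \<in> assignments (free_two m)" "alternating E"
    using alternating_assignment_exists by blast
  then obtain c where "E = two_diagram c c (replicate m c)"
    and "mirror E = two_diagram (\<not> c) (\<not> c) (replicate m (\<not> c))"
    by (rule two_knot_diagram)
  then have "two_diagram a a (replicate m a) \<in> {E, mirror E}"
    by (cases "c = a") auto
  then have "same_knot (two_diagram a a (replicate m a)) E"
    by (auto simp: same_knot_def)
  then show ?thesis using Suc E by auto
qed

lemma is_two_knot_positive:
  "excess a cs = int m \<Longrightarrow> is_two_knot m (two_diagram a a cs)"
  using isotopic_row_excess is_two_knot_alternating is_two_knot_isotopic by blast

text \<open>The row reduces to \<open>m + 1\<close> crossings opposite to the column. The flype uses
  up one and negates the column, and the other \<open>m\<close> then agree with it.\<close>

lemma is_two_knot_negative: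
  assumes "excess a cs = - int (Suc m)"
  shows "is_two_knot m (two_diagram a a cs)"
proof -
  have "isotopic (two_diagram a a cs) (two_diagram a a (replicate (Suc m) (\<not> a)))"
    using assms by (intro isotopic_row_excess) (simp add: excess_Not)
  also have "isotopic \<dots> (two_diagram (\<not> a) (\<not> a) (replicate m (\<not> a)))"
    using isotopic_flype by simp
  finally show ?thesis using is_two_knot_alternating is_two_knot_isotopic by blast
qed

text \<open>Reads the divisors of the determinant \<open>2 m + 1\<close> off the knot type. The
  unknot fits in with determinant 1, having \<open>q\<close> colourings and not \<open>q\<close>
  squared.\<close>

lemma is_two_knot_colourings:
  assumes "is_two_knot m D" "q \<ge> 2"
  shows "colourings q D [] = (nat q)\<^sup>2 \<longleftrightarrow> q dvd 2 * int m + 1"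
proof (cases m)
  case 0
  have "mirror unknot = unknot" by (simp add: mirror_def unknot_def)
  then have "isotopic D unknot" using assms 0 by (simp add: same_knot_def)
  then have "colourings q D [] = nat q"
    using colourings_isotopic colourings_unknot by metis
  moreover have "nat q \<noteq> (nat q)\<^sup>2" using assms(2) by (simp add: power2_eq_square)
  moreover have "\<not> q dvd 1" using assms(2) by auto
  ultimately show ?thesis using 0 by simp
next
  case (Suc l)
  then obtain E where E: "E \<in> assignments (free_two m)" "alternating E" "same_knot D E"
    using assms(1) by auto
  obtain a where "E = two_diagram a a (replicate m a)"
    and "mirror E = two_diagram (\<not> a) (\<not> a) (replicate m (\<not> a))"
    using two_knot_diagram[OF E(1,2)] .
  with E(3) obtain c where "isotopic D (two_diagram c c (replicate m c))"
    by (auto simp: same_knot_def)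
  then show ?thesis
    using colourings_isotopic all_colourings_iff_dvd[OF assms(2), of c "replicate m c"]
    by (simp add: excess_replicate)
qed

text \<open>Modulo its own determinant the knot has \<open>q\<close> squared colourings, but a
  cancelling column allows only \<open>q\<close>. For \<open>m = 0\<close> this modulus would be 1
  and distinguish nothing.\<close>

lemma is_two_knot_column_twisted:
  assumes "is_two_knot m (two_diagram a b cs)" "m \<ge> 1"
  shows "a = b"
proof (rule ccontr)
  assume "a \<noteq> b"
  moreover define q where "q = 2 * int m + 1"
  ultimately have "nat q = (nat q)\<^sup>2"
    using is_two_knot_colourings[OF assms(1), of q] assms(2) colourings_cancelling_column[of a b q cs]
    by simp
  then show False using assms(2) by (simp add: q_def power2_eq_square)
qed

text \<open>The two odd determinants have the same divisors from 2 on, so they divide each other and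
  agree up to sign; the two signs give the two values of the excess.\<close>

lemma is_two_knot_excess:
  assumes "is_two_knot m (two_diagram a a cs)"
  shows "excess a cs = int m \<or> excess a cs = - int (Suc m)"
proof -
  let ?v = "2 * excess a cs + 1" and ?m = "2 * int m + 1"
  have dvd: "q dvd ?v \<longleftrightarrow> q dvd ?m" if "q \<ge> 2" for q
    using is_two_knot_colourings[OF assms that] all_colourings_iff_dvd[OF that, of a cs] by simp
  have "\<bar>?v\<bar> \<ge> 1" by presburger
  then have "\<bar>?v\<bar> dvd ?m"
    by (cases "\<bar>?v\<bar> = 1") (use dvd[of "\<bar>?v\<bar>"] in simp_all)
  moreover have "?m dvd ?v"
    by (cases "?m = 1") (use dvd[of ?m] in simp_all)
  ultimately have "\<bar>?v\<bar> = ?m"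
    by (intro zdvd_antisym_nonneg) simp_all
  then show ?thesis by presburger
qed


section \<open>Counting\<close>

lemma finite_bool_lists: "finite {cs :: bool list. length cs = n \<and> P cs}"
  using finite_lists_length_eq[of "UNIV :: bool set" n] by (rule rev_finite_subset) auto

text \<open>Splitting by the first bit gives Pascal's rule.\<close>

lemma card_bool_lists_count:
  "card {cs :: bool list. length cs = n \<and> count_list cs a = j} = n choose j"
proof (induction n arbitrary: j)
  case 0
  have "{cs :: bool list. length cs = 0 \<and> count_list cs a = j} = (if j = 0 then {[]} else {})"
    by auto
  then show ?case by (cases j) simp_all
next
  case (Suc n)
  let ?S = "\<lambda>n j. {cs :: bool list. length cs = n \<and> count_list cs a = j}"
  have "?S (Suc n) j = (#) (\<not> a) ` ?S n j \<union> (if j = 0 then {} else (#) a ` ?S n (j - 1))"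
    by (cases a; cases "j = 0") (auto simp: length_Suc_conv image_iff split: if_splits)
  moreover have "(#) (\<not> a) ` ?S n j \<inter> (if j = 0 then {} else (#) a ` ?S n (j - 1)) = {}"
    by auto
  ultimately have "card (?S (Suc n) j) =
      card ((#) (\<not> a) ` ?S n j) + card (if j = 0 then {} else (#) a ` ?S n (j - 1))"
    by (simp add: card_Un_disjoint finite_bool_lists)
  also have "\<dots> = (n choose j) + (if j = 0 then 0 else n choose (j - 1))"
    by (simp add: card_image Suc.IH)
  also have "\<dots> = Suc n choose j" by (cases j) simp_all
  finally show ?case .
qed

lemma card_assignments: "card (assignments (free_two n)) = 2 ^ (n + 2)"
proof -
  let ?L = "{cs :: bool list. length cs = n}"
  have "assignments (free_two n) = (\<lambda>(a, b, cs). two_diagram a b cs) ` (UNIV \<times> UNIV \<times> ?L)"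
    by (auto simp: assignments_free_two image_iff)
  moreover have "inj (\<lambda>(a, b, cs). two_diagram a b cs)"
    by (auto simp: inj_on_def)
  ultimately have "card (assignments (free_two n)) = card ((UNIV \<times> UNIV \<times> ?L) :: (bool \<times> bool \<times> _) set)"
    by (metis card_image inj_on_subset subset_UNIV)
  then show ?thesis
    using card_lists_length_eq[of "UNIV :: bool set" n] by (simp add: card_cartesian_product)
qed

text \<open>The factor 2 is the choice of the common column bit \<open>a\<close>; \<open>f\<close>
  allows counting either the row crossings that differ from \<open>a\<close> or those that agree
  with it.\<close>

lemma card_twisted_columns:
  assumes "\<And>a b cs. length cs = n \<Longrightarrow> P (two_diagram a b cs) \<longleftrightarrow> a = b \<and> count_list cs (f a) = j"
  shows "card {D \<in> assignments (free_two n). P D} = 2 * (n choose j)"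
proof -
  let ?S = "\<lambda>a. {cs. length cs = n \<and> count_list cs (f a) = j}"
  have "{D \<in> assignments (free_two n). P D} = (\<lambda>(a, cs). two_diagram a a cs) ` Sigma UNIV ?S"
    using assms by (auto simp: assignments_free_two image_iff)
  moreover have "inj_on (\<lambda>(a, cs). two_diagram a a cs) (Sigma UNIV ?S)"
    by (auto simp: inj_on_def)
  ultimately have "card {D \<in> assignments (free_two n). P D} = card (Sigma UNIV ?S)"
    by (simp add: card_image)
  also have "\<dots> = (\<Sum>a \<in> UNIV. card (?S a))"
    by (simp add: finite_bool_lists)
  also have "\<dots> = 2 * (n choose j)" by (simp add: card_bool_lists_count)
  finally show ?thesis .
qed

theorem theorem5p3:
  fixes n k :: nat
  assumes "1 \<le> k" and "k \<le> n" and "even n \<longleftrightarrow> even k"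
  shows "card (assignments (free_two n)) = 2 ^ (n + 2)
    \<and> card {D \<in> assignments (free_two n). is_two_knot k D} = 2 * (n choose ((n - k) div 2))
    \<and> card {D \<in> assignments (free_two n). is_two_knot (k - 1) D
                \<and> (k = 1 \<longrightarrow> \<not> column_cancels D)} = 2 * (n choose ((n - k) div 2))"
proof -
  have "even (n - k)" using assms(3) by simp
  \<comment> \<open>\<open>j\<close> will be the number of row crossings with the rarer bit.\<close>
  then obtain j where "n - k = 2 * j" by (elim evenE)
  then have n: "n = k + 2 * j" using assms(2) by simp
  then have j: "(n - k) div 2 = j" by simp
  have excess: "excess a cs = int n - 2 * int (count_list cs (\<not> a))"
    "excess a cs = 2 * int (count_list cs a) - int n" if "length cs = n" for a cs
    using that length_eq_count_list[of cs a] by (auto simp: excess_def)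
  have "is_two_knot k (two_diagram a b cs) \<longleftrightarrow> a = b \<and> count_list cs (\<not> a) = j"
    if len: "length cs = n" for a b cs
  proof -
    \<comment> \<open>The excess has the parity of \<open>n\<close>, hence of \<open>k\<close>,
      which excludes \<open>- (k + 1)\<close> and leaves the value \<open>k\<close>.\<close>
    have "excess a cs \<noteq> - int (Suc k)"
      using excess(1)[OF len, of a] n by simp presburger
    then have "is_two_knot k (two_diagram a a cs) \<longleftrightarrow> excess a cs = int k"
      using is_two_knot_positive is_two_knot_excess by blast
    also have "\<dots> \<longleftrightarrow> count_list cs (\<not> a) = j"
      using excess(1)[OF len, of a] n by auto
    finally show ?thesis using is_two_knot_column_twisted assms(1) by blast
  qed
  moreover have "is_two_knot (k - 1) (two_diagram a b cs)
      \<and> (k = 1 \<longrightarrow> \<not> column_cancels (two_diagram a b cs)) \<longleftrightarrow> a = b \<and> count_list cs a = j"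
    if len: "length cs = n" for a b cs
  proof -
    have k: "Suc (k - 1) = k" using assms(1) by simp
    \<comment> \<open>By parity again \<open>k - 1\<close> is impossible; the other value is
      \<open>- Suc (k - 1) = - k\<close>, attained when exactly \<open>j\<close> row crossings agree
      with the column.\<close>
    have "excess a cs \<noteq> int (k - 1)"
      using excess(1)[OF len, of a] n assms(1) by (simp add: of_nat_diff) presburger
    then have "is_two_knot (k - 1) (two_diagram a a cs) \<longleftrightarrow> excess a cs = - int k"
      using is_two_knot_negative[of a cs "k - 1"] is_two_knot_excess[of "k - 1" a cs]
      unfolding k by blast
    also have "\<dots> \<longleftrightarrow> count_list cs a = j"
      using excess(2)[OF len, of a] n by auto
    \<comment> \<open>For \<open>k > 1\<close> the colourings give \<open>a = b\<close>; for
      \<open>k = 1\<close> this comes from the condition that the column does not cancel.\<close>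
    finally show ?thesis
      using is_two_knot_column_twisted[of "k - 1" a b cs] assms(1)
      by (cases "k = 1") (auto simp: column_cancels_two_diagram)
  qed
  ultimately show ?thesis
    unfolding j
    by (intro conjI card_assignments card_twisted_columns[where f = Not]
        card_twisted_columns[where f = id]) simp_all
qed

end
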